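(* Let $R$ be a commutative ring and $\mathcal{P}$ an operad over $R$. Then a $\mathcal{P}$-algebra $A$ is a differential object in $(\mathsf{ALG}_{\mathcal{P}},\mathbb{T})$ (in a necessarily unique way) if and only if $\mu(a_1,\dots,a_n)=0$ for all $n\neq1$, all $\mu\in\mathcal{P}(n)$ and all $a_1,\dots,a_n\in A$.
   Context: $R$ is a commutative ring. An operad $\mathcal{P}$ is a symmetric operad in $R$-modules ($R$-modules $\mathcal{P}(n)$, $n\ge0$, with right $\Sigma(n)$-actions, unit and compositions with the usual axioms). $\mathsf{ALG}_{\mathcal{P}}$ is the category of $\mathcal{P}$-algebras; operations are written $\mu(a_1,\dots,a_n)$ for $\mu\in\mathcal{P}(n)$; for $n=0$ this is the constant $\mu_A\in A$. Products of $\mathcal{P}$-algebras are computed on underlying modules with componentwise operations; the terminal object $\ast$ is the zero module. The Cartesian Rosický tangent structure $\mathbb{T}$ on $\mathsf{ALG}_{\mathcal{P}}$: $\mathsf{T}(A)=A\ltimes A$ is $A\times A$ with $\mu((a_1,b_1),\dots,(a_n,b_n))=(\mu(a_1,\dots,a_n),\sum_i\mu(a_1,\dots,b_i,\dots,a_n))$; $\mathsf{T}(f)=f\times f$; $p_A(a,b)=a$; $\mathsf{T}_2(A)=\{(a,b_1,b_2)\}$ with $q_j(a,b_1,b_2)=(a,b_j)$; $s_A(a,b_1,b_2)=(a,b_1+b_2)$; $z_A(a)=(a,0)$; $l_A(a,b)=(a,0,0,b)$; $c_A(a,b,c,d)=(a,c,b,d)$; $n_A(a,b)=(a,-b)$.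 A differential object in a Cartesian tangent category is a quadruple $(A,\hat p,\sigma,\zeta)$ with $\hat p:\mathsf{T}(A)\to A$, $\sigma:A\times A\to A$, $\zeta:\ast\to A$ such that $(A,\sigma,\zeta)$ is a commutative monoid; $\langle p_A,\hat p\rangle:\mathsf{T}(A)\to A\times A$ is an isomorphism; $\hat p\circ s_A=\sigma\circ\langle\hat p\circ q_1,\hat p\circ q_2\rangle$ and $\hat p\circ z_A=\zeta\circ t_A$ (with $t_A:A\to\ast$); $\hat p\circ\mathsf{T}(\sigma)=\sigma\circ(\hat p\times\hat p)$ (modulo $\mathsf{T}(A\times A)\cong\mathsf{T}(A)\times\mathsf{T}(A)$) and $\hat p\circ\mathsf{T}(\zeta)=\zeta\circ t_{\mathsf{T}(\ast)}$; and $\hat p\circ\mathsf{T}(\hat p)\circ l_A=\hat p$. *)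

theory Defs
  imports "HOL-Combinatorics.Permutations" "HOL-Algebra.Module"
begin

section \<open>Linear and multilinear maps\<close>

definition linear_maps ::
  "('r, 's) ring_scheme \<Rightarrow> ('r, 'a, 'x) module_scheme \<Rightarrow> ('r, 'b, 'y) module_scheme \<Rightarrow> ('a \<Rightarrow> 'b) set"
where
  "linear_maps R M N = {f \<in> carrier M \<rightarrow> carrier N.
     (\<forall>x \<in> carrier M. \<forall>y \<in> carrier M. f (x \<oplus>\<^bsub>M\<^esub> y) = f x \<oplus>\<^bsub>N\<^esub> f y) \<and>
     (\<forall>r \<in> carrier R. \<forall>x \<in> carrier M. f (r \<odot>\<^bsub>M\<^esub> x) = r \<odot>\<^bsub>N\<^esub> f x)}"

text \<open>A map of several arguments is a function on lists. The elements of the product of the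
  modules in \<open>Ms\<close> are the members of \<open>listset (map carrier Ms)\<close>.\<close>

definition multilinear ::
  "('r, 's) ring_scheme \<Rightarrow> ('r, 'a, 'x) module_scheme list \<Rightarrow> ('r, 'b, 'y) module_scheme
     \<Rightarrow> ('a list \<Rightarrow> 'b) \<Rightarrow> bool"
where
  "multilinear R Ms N f \<longleftrightarrow>
     (\<forall>i < length Ms. \<forall>xs \<in> listset (map carrier Ms).
        (\<lambda>x. f (xs[i := x])) \<in> linear_maps R (Ms ! i) N)"


section \<open>Permutations of blocks\<close>

text \<open>For a list of block lengths \<open>ns\<close>, the positions \<open>{..<sum_list ns}\<close> are cut into
  \<open>length ns\<close> consecutive blocks. Position \<open>p\<close> lies in block \<open>block_of ns p\<close>, and that block starts
  at position \<open>offset ns (block_of ns p)\<close>. Empty blocks are allowed.\<close>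

definition offset :: "nat list \<Rightarrow> nat \<Rightarrow> nat" where
  "offset ns i = sum_list (take i ns)"

definition block_of :: "nat list \<Rightarrow> nat \<Rightarrow> nat" where
  "block_of ns p = (LEAST i. p < offset ns (Suc i))"

text \<open>\<open>block_perm ns \<sigma>\<close> is the permutation \<open>\<sigma>(n\<^sub>1,\<dots>,n\<^sub>k)\<close> that moves the \<open>i\<close>-th block, as a whole,
  to the \<open>\<sigma> i\<close>-th place, where the block lengths are \<open>n\<close> at \<open>\<sigma>\<^sup>-\<^sup>1 0, \<sigma>\<^sup>-\<^sup>1 1, \<dots>\<close>.
  \<open>sum_perm ns \<tau>s\<close> is the block sum \<open>\<tau>\<^sub>1 \<oplus> \<dots> \<oplus> \<tau>\<^sub>k\<close>.\<close>

definition block_perm :: "nat list \<Rightarrow> (nat \<Rightarrow> nat) \<Rightarrow> nat \<Rightarrow> nat" where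
  "block_perm ns \<sigma> p =
     (if p < sum_list ns
      then offset (permute_list (inv_into UNIV \<sigma>) ns) (\<sigma> (block_of ns p))
             + (p - offset ns (block_of ns p))
      else p)"

definition sum_perm :: "nat list \<Rightarrow> (nat \<Rightarrow> nat) list \<Rightarrow> nat \<Rightarrow> nat" where
  "sum_perm ns \<tau>s p =
     (if p < sum_list ns
      then offset ns (block_of ns p) + (\<tau>s ! block_of ns p) (p - offset ns (block_of ns p))
      else p)"


section \<open>Symmetric operads in modules\<close>

text \<open>\<open>op_comp P [n\<^sub>1,\<dots>,n\<^sub>k] \<mu> [\<nu>\<^sub>1,\<dots>,\<nu>\<^sub>k]\<close> is the composite \<open>\<gamma>(\<mu>; \<nu>\<^sub>1,\<dots>,\<nu>\<^sub>k)\<close> of \<open>\<mu> \<in> P(k)\<close> with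
  \<open>\<nu>\<^sub>i \<in> P(n\<^sub>i)\<close>; the arities are explicit because the carriers of the modules \<open>P(n)\<close> are sets over
  one type and may overlap. \<open>op_perm P n \<mu> \<sigma>\<close> is \<open>\<mu> \<cdot> \<sigma>\<close>, with \<open>\<Sigma>(n)\<close> the permutations of \<open>{..<n}\<close>.\<close>

record ('r, 'p) operad_data =
  op_mod :: "nat \<Rightarrow> ('r, 'p) module"
  op_perm :: "nat \<Rightarrow> 'p \<Rightarrow> (nat \<Rightarrow> nat) \<Rightarrow> 'p"
  op_unit :: 'p
  op_comp :: "nat list \<Rightarrow> 'p \<Rightarrow> 'p list \<Rightarrow> 'p"

abbreviation op_carrier :: "('r, 'p, 'x) operad_data_scheme \<Rightarrow> nat \<Rightarrow> 'p set" where
  "op_carrier P n \<equiv> carrier (op_mod P n)"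

locale operad = cring R for R (structure) +
  fixes P :: "('a, 'p) operad_data"
  assumes op_module: "module R (op_mod P n)"
    and op_perm_linear:
      "\<sigma> permutes {..<n} \<Longrightarrow> (\<lambda>\<mu>. op_perm P n \<mu> \<sigma>) \<in> linear_maps R (op_mod P n) (op_mod P n)"
    and op_perm_id: "\<mu> \<in> op_carrier P n \<Longrightarrow> op_perm P n \<mu> id = \<mu>"
    and op_perm_comp:
      "\<lbrakk>\<mu> \<in> op_carrier P n; \<sigma> permutes {..<n}; \<tau> permutes {..<n}\<rbrakk>
         \<Longrightarrow> op_perm P n \<mu> (\<sigma> \<circ> \<tau>) = op_perm P n (op_perm P n \<mu> \<sigma>) \<tau>"
    and op_unit_closed: "op_unit P \<in> op_carrier P 1"
    and op_comp_linear_left: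
      "\<nu>s \<in> listset (map (op_carrier P) ns)
         \<Longrightarrow> (\<lambda>\<mu>. op_comp P ns \<mu> \<nu>s) \<in> linear_maps R (op_mod P (length ns)) (op_mod P (sum_list ns))"
    and op_comp_multilinear_right:
      "\<mu> \<in> op_carrier P (length ns)
         \<Longrightarrow> multilinear R (map (op_mod P) ns) (op_mod P (sum_list ns)) (op_comp P ns \<mu>)"
    and op_unit_left: "\<mu> \<in> op_carrier P n \<Longrightarrow> op_comp P [n] (op_unit P) [\<mu>] = \<mu>"
    and op_unit_right:
      "\<mu> \<in> op_carrier P n \<Longrightarrow> op_comp P (replicate n 1) \<mu> (replicate n (op_unit P)) = \<mu>"
    and op_assoc:
      "\<lbrakk>\<mu> \<in> op_carrier P (length mss);
        \<nu>s \<in> listset (map (\<lambda>ms. op_carrier P (length ms)) mss);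
        \<xi>ss \<in> listset (map (\<lambda>ms. listset (map (op_carrier P) ms)) mss)\<rbrakk>
         \<Longrightarrow> op_comp P (concat mss) (op_comp P (map length mss) \<mu> \<nu>s) (concat \<xi>ss) =
             op_comp P (map sum_list mss) \<mu>
               (map (\<lambda>i. op_comp P (mss ! i) (\<nu>s ! i) (\<xi>ss ! i)) [0..<length mss])"
    and op_equivariant_left:
      "\<lbrakk>\<mu> \<in> op_carrier P (length ns); \<nu>s \<in> listset (map (op_carrier P) ns);
        \<sigma> permutes {..<length ns}\<rbrakk>
         \<Longrightarrow> op_comp P ns (op_perm P (length ns) \<mu> \<sigma>) \<nu>s =
             op_perm P (sum_list ns)
               (op_comp P (permute_list (inv_into UNIV \<sigma>) ns) \<mu> (permute_list (inv_into UNIV \<sigma>) \<nu>s))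
               (block_perm ns \<sigma>)"
    and op_equivariant_right:
      "\<lbrakk>\<mu> \<in> op_carrier P (length ns); \<nu>s \<in> listset (map (op_carrier P) ns);
        length \<tau>s = length ns; \<forall>i < length ns. \<tau>s ! i permutes {..<ns ! i}\<rbrakk>
         \<Longrightarrow> op_comp P ns \<mu> (map (\<lambda>i. op_perm P (ns ! i) (\<nu>s ! i) (\<tau>s ! i)) [0..<length ns]) =
             op_perm P (sum_list ns) (op_comp P ns \<mu> \<nu>s) (sum_perm ns \<tau>s)"


section \<open>Algebras over an operad\<close>

text \<open>\<open>oper A n \<mu> [a\<^sub>1,\<dots>,a\<^sub>n]\<close> is \<open>\<mu>(a\<^sub>1,\<dots>,a\<^sub>n)\<close>. The fields \<open>mult\<close> and \<open>one\<close> inherited from the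
  module record carry no meaning here, as in \<^locale>\<open>module\<close>.\<close>

record ('r, 'a, 'p) alg_data = "('r, 'a) module" +
  oper :: "nat \<Rightarrow> 'p \<Rightarrow> 'a list \<Rightarrow> 'a"

abbreviation tuples :: "nat \<Rightarrow> ('r, 'a, 'p, 'x) alg_data_scheme \<Rightarrow> 'a list set" where
  "tuples n A \<equiv> listset (replicate n (carrier A))"

locale operad_algebra = operad R P + module R A
  for R (structure) and P and A :: "('a, 'b, 'p) alg_data" (structure) +
  assumes oper_linear_left:
      "as \<in> tuples n A \<Longrightarrow> (\<lambda>\<mu>. oper A n \<mu> as) \<in> linear_maps R (op_mod P n) A"
    and oper_multilinear_right:
      "\<mu> \<in> op_carrier P n \<Longrightarrow> multilinear R (replicate n A) A (oper A n \<mu>)"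
    and oper_unit: "a \<in> carrier A \<Longrightarrow> oper A 1 (op_unit P) [a] = a"
    and oper_comp:
      "\<lbrakk>\<mu> \<in> op_carrier P (length ns); \<nu>s \<in> listset (map (op_carrier P) ns);
        ass \<in> listset (map (\<lambda>n. tuples n A) ns)\<rbrakk>
         \<Longrightarrow> oper A (sum_list ns) (op_comp P ns \<mu> \<nu>s) (concat ass) =
             oper A (length ns) \<mu>
               (map (\<lambda>i. oper A (ns ! i) (\<nu>s ! i) (ass ! i)) [0..<length ns])"
    and oper_equivariant:
      "\<lbrakk>\<mu> \<in> op_carrier P n; \<sigma> permutes {..<n}; as \<in> tuples n A\<rbrakk>
         \<Longrightarrow> oper A n (op_perm P n \<mu> \<sigma>) as = oper A n \<mu> (permute_list (inv_into UNIV \<sigma>) as)"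

text \<open>As with \<^const>\<open>hom\<close>, two functions that agree on the carrier represent the same morphism.\<close>

definition alg_hom ::
  "('r, 's) ring_scheme \<Rightarrow> ('r, 'p) operad_data \<Rightarrow> ('r, 'a, 'p) alg_data \<Rightarrow> ('r, 'b, 'p) alg_data
     \<Rightarrow> ('a \<Rightarrow> 'b) set"
where
  "alg_hom R P A B = {f \<in> linear_maps R A B.
     \<forall>n. \<forall>\<mu> \<in> op_carrier P n. \<forall>as \<in> tuples n A. f (oper A n \<mu> as) = oper B n \<mu> (map f as)}"

definition alg_iso ::
  "('r, 's) ring_scheme \<Rightarrow> ('r, 'p) operad_data \<Rightarrow> ('r, 'a, 'p) alg_data \<Rightarrow> ('r, 'b, 'p) alg_data
     \<Rightarrow> ('a \<Rightarrow> 'b) set"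
where
  "alg_iso R P A B = {f \<in> alg_hom R P A B.
     \<exists>g \<in> alg_hom R P B A. (\<forall>x \<in> carrier A. g (f x) = x) \<and> (\<forall>y \<in> carrier B. f (g y) = y)}"

definition prod_alg ::
  "('r, 'a, 'p) alg_data \<Rightarrow> ('r, 'b, 'p) alg_data \<Rightarrow> ('r, 'a \<times> 'b, 'p) alg_data"
where
  "prod_alg A B =
    \<lparr>carrier = carrier A \<times> carrier B,
     mult = (\<lambda>x y. (fst x \<otimes>\<^bsub>A\<^esub> fst y, snd x \<otimes>\<^bsub>B\<^esub> snd y)),
     one = (\<one>\<^bsub>A\<^esub>, \<one>\<^bsub>B\<^esub>),
     zero = (\<zero>\<^bsub>A\<^esub>, \<zero>\<^bsub>B\<^esub>),
     add = (\<lambda>x y. (fst x \<oplus>\<^bsub>A\<^esub> fst y, snd x \<oplus>\<^bsub>B\<^esub> snd y)),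
     smult = (\<lambda>r x. (r \<odot>\<^bsub>A\<^esub> fst x, r \<odot>\<^bsub>B\<^esub> snd x)),
     oper = (\<lambda>n \<mu> xs. (oper A n \<mu> (map fst xs), oper B n \<mu> (map snd xs)))\<rparr>"

definition terminal_alg :: "('r, unit, 'p) alg_data" where
  "terminal_alg =
    \<lparr>carrier = {()}, mult = (\<lambda>_ _. ()), one = (), zero = (), add = (\<lambda>_ _. ()),
     smult = (\<lambda>_ _. ()), oper = (\<lambda>_ _ _. ())\<rparr>"


section \<open>The tangent structure\<close>

text \<open>The sum \<open>\<Sum>\<^sub>i \<mu>(a\<^sub>1,\<dots>,b\<^sub>i,\<dots>,a\<^sub>n)\<close>.\<close>

definition oper_deriv :: "('r, 'a, 'p) alg_data \<Rightarrow> nat \<Rightarrow> 'p \<Rightarrow> 'a list \<Rightarrow> 'a list \<Rightarrow> 'a" where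
  "oper_deriv A n \<mu> as bs = (\<Oplus>\<^bsub>A\<^esub> i \<in> {..<n}. oper A n \<mu> (as[i := bs ! i]))"

definition tangent :: "('r, 'a, 'p) alg_data \<Rightarrow> ('r, 'a \<times> 'a, 'p) alg_data" where
  "tangent A = (prod_alg A A)
    \<lparr>oper := (\<lambda>n \<mu> xs. (oper A n \<mu> (map fst xs), oper_deriv A n \<mu> (map fst xs) (map snd xs)))\<rparr>"

definition tangent2 :: "('r, 'a, 'p) alg_data \<Rightarrow> ('r, 'a \<times> 'a \<times> 'a, 'p) alg_data" where
  "tangent2 A = (prod_alg A (prod_alg A A))
    \<lparr>oper := (\<lambda>n \<mu> xs.
       (oper A n \<mu> (map fst xs),
        oper_deriv A n \<mu> (map fst xs) (map (fst \<circ> snd) xs),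
        oper_deriv A n \<mu> (map fst xs) (map (snd \<circ> snd) xs)))\<rparr>"

definition tan_map :: "('a \<Rightarrow> 'b) \<Rightarrow> 'a \<times> 'a \<Rightarrow> 'b \<times> 'b" where
  "tan_map f = map_prod f f"

definition tan_proj :: "'a \<times> 'a \<Rightarrow> 'a" where
  "tan_proj = (\<lambda>(a, b). a)"

definition tan_q1 :: "'a \<times> 'a \<times> 'a \<Rightarrow> 'a \<times> 'a" where
  "tan_q1 = (\<lambda>(a, b1, b2). (a, b1))"

definition tan_q2 :: "'a \<times> 'a \<times> 'a \<Rightarrow> 'a \<times> 'a" where
  "tan_q2 = (\<lambda>(a, b1, b2). (a, b2))"

definition tan_sum :: "('r, 'a, 'p) alg_data \<Rightarrow> 'a \<times> 'a \<times> 'a \<Rightarrow> 'a \<times> 'a" where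
  "tan_sum A = (\<lambda>(a, b1, b2). (a, b1 \<oplus>\<^bsub>A\<^esub> b2))"

definition tan_zero :: "('r, 'a, 'p) alg_data \<Rightarrow> 'a \<Rightarrow> 'a \<times> 'a" where
  "tan_zero A = (\<lambda>a. (a, \<zero>\<^bsub>A\<^esub>))"

definition tan_lift :: "('r, 'a, 'p) alg_data \<Rightarrow> 'a \<times> 'a \<Rightarrow> ('a \<times> 'a) \<times> ('a \<times> 'a)" where
  "tan_lift A = (\<lambda>(a, b). ((a, \<zero>\<^bsub>A\<^esub>), (\<zero>\<^bsub>A\<^esub>, b)))"

definition tan_flip :: "('a \<times> 'a) \<times> ('a \<times> 'a) \<Rightarrow> ('a \<times> 'a) \<times> ('a \<times> 'a)" where
  "tan_flip = (\<lambda>((a, b), (c, d)). ((a, c), (b, d)))"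

definition tan_neg :: "('r, 'a, 'p) alg_data \<Rightarrow> 'a \<times> 'a \<Rightarrow> 'a \<times> 'a" where
  "tan_neg A = (\<lambda>(a, b). (a, \<ominus>\<^bsub>A\<^esub> b))"

text \<open>The canonical isomorphism from the tangent of a product to the product of the tangents.\<close>

definition tan_prod :: "('a \<times> 'b) \<times> ('a \<times> 'b) \<Rightarrow> ('a \<times> 'a) \<times> ('b \<times> 'b)" where
  "tan_prod = (\<lambda>((a, b), (a', b')). ((a, a'), (b, b')))"


section \<open>Differential objects\<close>

definition pairing :: "('c \<Rightarrow> 'a) \<Rightarrow> ('c \<Rightarrow> 'b) \<Rightarrow> 'c \<Rightarrow> 'a \<times> 'b" where
  "pairing f g = (\<lambda>x. (f x, g x))"

definition to_terminal :: "'a \<Rightarrow> unit" where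
  "to_terminal = (\<lambda>_. ())"

definition comm_monoid_object ::
  "('r, 's) ring_scheme \<Rightarrow> ('r, 'p) operad_data \<Rightarrow> ('r, 'a, 'p) alg_data
     \<Rightarrow> ('a \<times> 'a \<Rightarrow> 'a) \<Rightarrow> (unit \<Rightarrow> 'a) \<Rightarrow> bool"
where
  "comm_monoid_object R P A \<sigma> \<zeta> \<longleftrightarrow>
     \<sigma> \<in> alg_hom R P (prod_alg A A) A \<and>
     \<zeta> \<in> alg_hom R P terminal_alg A \<and>
     (\<forall>x \<in> carrier A. \<forall>y \<in> carrier A. \<forall>z \<in> carrier A. \<sigma> (\<sigma> (x, y), z) = \<sigma> (x, \<sigma> (y, z))) \<and>
     (\<forall>x \<in> carrier A. \<sigma> (\<zeta> (), x) = x \<and> \<sigma> (x, \<zeta> ()) = x) \<and>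
     (\<forall>x \<in> carrier A. \<forall>y \<in> carrier A. \<sigma> (x, y) = \<sigma> (y, x))"

definition differential_object ::
  "('r, 's) ring_scheme \<Rightarrow> ('r, 'p) operad_data \<Rightarrow> ('r, 'a, 'p) alg_data
     \<Rightarrow> ('a \<times> 'a \<Rightarrow> 'a) \<Rightarrow> ('a \<times> 'a \<Rightarrow> 'a) \<Rightarrow> (unit \<Rightarrow> 'a) \<Rightarrow> bool"
where
  "differential_object R P A p \<sigma> \<zeta> \<longleftrightarrow>
     p \<in> alg_hom R P (tangent A) A \<and>
     comm_monoid_object R P A \<sigma> \<zeta> \<and>
     pairing tan_proj p \<in> alg_iso R P (tangent A) (prod_alg A A) \<and>
     (\<forall>x \<in> carrier (tangent2 A).
        (p \<circ> tan_sum A) x = (\<sigma> \<circ> pairing (p \<circ> tan_q1) (p \<circ> tan_q2)) x) \<and>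
     (\<forall>x \<in> carrier A. (p \<circ> tan_zero A) x = (\<zeta> \<circ> to_terminal) x) \<and>
     (\<forall>x \<in> carrier (tangent (prod_alg A A)).
        (p \<circ> tan_map \<sigma>) x = (\<sigma> \<circ> map_prod p p \<circ> tan_prod) x) \<and>
     (\<forall>x \<in> carrier (tangent (terminal_alg :: ('r, unit, 'p) alg_data)). (p \<circ> tan_map \<zeta>) x = (\<zeta> \<circ> to_terminal) x) \<and>
     (\<forall>x \<in> carrier (tangent A). (p \<circ> tan_map p \<circ> tan_lift A) x = p x)"

end

theory Submission
  imports Defs
begin

text \<open>The zero of a differential object is \<open>0\<close> because \<open>\<zeta>\<close> is linear, and then the unit laws
  and the linearity of \<open>\<sigma>\<close> force \<open>\<sigma>(x, y) = x + y\<close>. That \<open>\<zeta>\<close> preserves constants kills the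
  nullary operations. That \<open>\<sigma>\<close> preserves an operation \<open>\<mu>\<close> of arity \<open>n \<ge> 2\<close> gives
  \<open>\<mu>(a\<^sub>1,\<dots>,a\<^sub>n) = \<mu>(a\<^sub>1,0,\<dots>,0) + \<mu>(0,a\<^sub>2,\<dots>,a\<^sub>n) = 0\<close>. Moreover \<open>p(a, b) = g(b)\<close> with
  \<open>g(b) = p(0, b)\<close>; the lift axiom makes \<open>g\<close> idempotent and the isomorphism makes it injective, so
  \<open>g\<close> is the identity. Conversely, if only the unary operations survive, the tangent algebra is
  the product \<open>A \<times> A\<close>, and the second projection, addition and zero form a differential object.\<close>

lemma listset_replicate: "listset (replicate n C) = {xs. length xs = n \<and> set xs \<subseteq> C}"
proof (induction n)
  case (Suc n)
  then show ?case
    by (auto simp: set_Cons_def length_Suc_conv)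
qed auto

lemma prod_alg_simps [simp]:
  "carrier (prod_alg A B) = carrier A \<times> carrier B"
  "x \<oplus>\<^bsub>prod_alg A B\<^esub> y = (fst x \<oplus>\<^bsub>A\<^esub> fst y, snd x \<oplus>\<^bsub>B\<^esub> snd y)"
  "r \<odot>\<^bsub>prod_alg A B\<^esub> x = (r \<odot>\<^bsub>A\<^esub> fst x, r \<odot>\<^bsub>B\<^esub> snd x)"
  "oper (prod_alg A B) n \<mu> xs = (oper A n \<mu> (map fst xs), oper B n \<mu> (map snd xs))"
  by (simp_all add: prod_alg_def)

lemma tangent_simps [simp]:
  "carrier (tangent A) = carrier A \<times> carrier A"
  "x \<oplus>\<^bsub>tangent A\<^esub> y = (fst x \<oplus>\<^bsub>A\<^esub> fst y, snd x \<oplus>\<^bsub>A\<^esub> snd y)"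
  "r \<odot>\<^bsub>tangent A\<^esub> x = (r \<odot>\<^bsub>A\<^esub> fst x, r \<odot>\<^bsub>A\<^esub> snd x)"
  "oper (tangent A) n \<mu> xs =
     (oper A n \<mu> (map fst xs), oper_deriv A n \<mu> (map fst xs) (map snd xs))"
  by (simp_all add: tangent_def prod_alg_def)

lemma carrier_tangent2 [simp]:
  "carrier (tangent2 A) = carrier A \<times> carrier A \<times> carrier A"
  by (simp add: tangent2_def prod_alg_def)

lemma terminal_alg_simps [simp]:
  "carrier terminal_alg = {()}"
  by (simp add: terminal_alg_def)

lemma linear_mapsD:
  assumes "f \<in> linear_maps R M N"
  shows "x \<in> carrier M \<Longrightarrow> f x \<in> carrier N"
    and "\<lbrakk>x \<in> carrier M; y \<in> carrier M\<rbrakk> \<Longrightarrow> f (x \<oplus>\<^bsub>M\<^esub> y) = f x \<oplus>\<^bsub>N\<^esub> f y"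
  using assms by (auto simp: linear_maps_def)

text \<open>Additivity gives f e + f e = f e, and cancellation in \<open>N\<close> yields zero.
  Asking only for an idempotent \<open>e\<close> avoids having to know that \<open>M\<close> is a
  group: for \<open>terminal_alg\<close> the element \<open>()\<close> qualifies at once.\<close>

lemma linear_maps_idem:
  assumes f: "f \<in> linear_maps R M N" and N: "abelian_group N"
    and e: "e \<in> carrier M" "e \<oplus>\<^bsub>M\<^esub> e = e"
  shows "f e = \<zero>\<^bsub>N\<^esub>"
proof -
  interpret N: abelian_group N by (fact N)
  have "f e \<oplus>\<^bsub>N\<^esub> f e = f e"
    using linear_mapsD(2)[OF f e(1) e(1)] e(2) by simp
  then show ?thesis
    using linear_mapsD(1)[OF f e(1)] by (simp add: N.add.l_cancel_one)
qed

lemma alg_homD: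
  assumes "f \<in> alg_hom R P A B"
  shows "f \<in> linear_maps R A B"
    and "\<lbrakk>\<mu> \<in> op_carrier P n; as \<in> tuples n A\<rbrakk> \<Longrightarrow> f (oper A n \<mu> as) = oper B n \<mu> (map f as)"
  using assms by (auto simp: alg_hom_def)

context operad_algebra
begin

lemma oper_closed:
  assumes "\<mu> \<in> op_carrier P n" "as \<in> tuples n A"
  shows "oper A n \<mu> as \<in> carrier A"
  using linear_mapsD(1)[OF oper_linear_left[OF assms(2)] assms(1)] .

lemma oper_linear_slot:
  assumes "\<mu> \<in> op_carrier P n" "as \<in> tuples n A" "i < n"
  shows "(\<lambda>x. oper A n \<mu> (as[i := x])) \<in> linear_maps R A A"
  using oper_multilinear_right[OF assms(1)] assms by (simp add: multilinear_def)

lemma oper_zero_slot: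
  assumes "\<mu> \<in> op_carrier P n" "as \<in> tuples n A" "i < n" "as ! i = \<zero>\<^bsub>A\<^esub>"
  shows "oper A n \<mu> as = \<zero>\<^bsub>A\<^esub>"
  using linear_maps_idem[OF oper_linear_slot[OF assms(1-3)] M.abelian_group_axioms M.zero_closed]
  \<comment> \<open>Overwriting slot \<open>i\<close> with the zero it already holds returns
    \<open>as\<close>, so the value of the linear map at zero is the value of the operation at
    \<open>as\<close>.\<close>
  by (simp add: list_update_id[of as i, unfolded assms(4)])

lemma oper_unary_linear:
  assumes "\<mu> \<in> op_carrier P 1"
  shows "(\<lambda>x. oper A 1 \<mu> [x]) \<in> linear_maps R A A"
  using oper_linear_slot[OF assms, of "[\<zero>\<^bsub>A\<^esub>]" 0] by (simp add: listset_replicate)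

lemma comm_monoid_object_zero:
  assumes "comm_monoid_object R P A \<sigma> \<zeta>"
  shows "\<zeta> () = \<zero>\<^bsub>A\<^esub>"
proof -
  have "\<zeta> \<in> alg_hom R P terminal_alg A"
    using assms by (simp add: comm_monoid_object_def)
  from linear_maps_idem[OF alg_homD(1)[OF this] M.abelian_group_axioms] show ?thesis
    by simp
qed

text \<open>An Eckmann-Hilton argument: (x, y) = (x, 0) + (0, y) in the product, and since
  \<open>\<zeta> ()\<close> is zero the unit laws evaluate both summands.\<close>

lemma comm_monoid_object_add:
  assumes S: "comm_monoid_object R P A \<sigma> \<zeta>" and x: "x \<in> carrier A" and y: "y \<in> carrier A"
  shows "\<sigma> (x, y) = x \<oplus>\<^bsub>A\<^esub> y"
proof -
  have "\<sigma> \<in> linear_maps R (prod_alg A A) A"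
    using S by (simp add: comm_monoid_object_def alg_hom_def)
  from linear_mapsD(2)[OF this, of "(x, \<zero>\<^bsub>A\<^esub>)" "(\<zero>\<^bsub>A\<^esub>, y)"]
  have "\<sigma> (x, y) = \<sigma> (x, \<zero>\<^bsub>A\<^esub>) \<oplus>\<^bsub>A\<^esub> \<sigma> (\<zero>\<^bsub>A\<^esub>, y)"
    using x y by simp
  then show ?thesis
    using S comm_monoid_object_zero[OF S] x y by (simp add: comm_monoid_object_def)
qed

lemma comm_monoid_object_oper:
  assumes S: "comm_monoid_object R P A \<sigma> \<zeta>"
    and n: "n \<noteq> 1" and \<mu>: "\<mu> \<in> op_carrier P n" and as: "as \<in> tuples n A"
  shows "oper A n \<mu> as = \<zero>\<^bsub>A\<^esub>"
proof (cases "n = 0")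
  case True
  have "\<zeta> \<in> alg_hom R P terminal_alg A"
    using S by (simp add: comm_monoid_object_def)
  \<comment> \<open>A constant of \<open>terminal_alg\<close> can only be \<open>()\<close>, so its
    image \<open>\<zeta> ()\<close>, already known to be zero, is the constant of
    \<open>A\<close>.\<close>
  from alg_homD(2)[OF this \<mu>, of "[]"] show ?thesis
    using True as comm_monoid_object_zero[OF S] by simp
next
  case False
  with as obtain a bs where as_eq: "as = a # bs" and bs: "length bs = n - 1"
    and mem: "a \<in> carrier A" "set bs \<subseteq> carrier A"
    by (cases as) (auto simp: listset_replicate)
  let ?x = "a # map (\<lambda>_. \<zero>\<^bsub>A\<^esub>) bs"
  let ?y = "\<zero>\<^bsub>A\<^esub> # bs"
  have x: "?x \<in> tuples n A" and y: "?y \<in> tuples n A"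
    using False bs mem by (auto simp: listset_replicate)
  have \<sigma>: "\<sigma> \<in> alg_hom R P (prod_alg A A) A"
    using S by (simp add: comm_monoid_object_def)
  \<comment> \<open>Zipping turns the two lists into one tuple over the product algebra, the form in
    which \<open>\<sigma>\<close> preserves operations.\<close>
  have zip: "zip ?x ?y \<in> tuples n (prod_alg A A)"
    using False bs mem by (auto simp: listset_replicate set_zip)
  have "map \<sigma> (zip ?x ?y) = as"
    using mem
    by (auto simp: as_eq comm_monoid_object_add[OF S] subset_eq intro!: nth_equalityI)
  then have "oper A n \<mu> as = \<sigma> (oper A n \<mu> ?x, oper A n \<mu> ?y)"
    using alg_homD(2)[OF \<sigma> \<mu> zip] by simp
  moreover have "oper A n \<mu> ?x = \<zero>\<^bsub>A\<^esub>"
    \<comment> \<open>Here \<open>n \<ge> 2\<close> enters: slot 1 exists and holds a zero.\<close>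
    by (rule oper_zero_slot[OF \<mu> x, of 1]) (use False n bs in auto)
  moreover have "oper A n \<mu> ?y = \<zero>\<^bsub>A\<^esub>"
    by (rule oper_zero_slot[OF \<mu> y, of 0]) (use False in auto)
  ultimately show ?thesis
    using comm_monoid_object_add[OF S] by simp
qed

lemma differential_object_snd:
  assumes D: "differential_object R P A p \<sigma> \<zeta>" and a: "a \<in> carrier A" and b: "b \<in> carrier A"
  shows "p (a, b) = b"
proof -
  have S: "comm_monoid_object R P A \<sigma> \<zeta>" and "p \<in> alg_hom R P (tangent A) A"
    using D by (simp_all add: differential_object_def)
  then have p: "p \<in> linear_maps R (tangent A) A"
    by (simp add: alg_homD(1))
  have zero: "p (x, \<zero>\<^bsub>A\<^esub>) = \<zero>\<^bsub>A\<^esub>" if "x \<in> carrier A" for x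
    using D that comm_monoid_object_zero[OF S]
    by (simp add: differential_object_def tan_zero_def to_terminal_def)
  have closed: "p (x, y) \<in> carrier A" if "x \<in> carrier A" "y \<in> carrier A" for x y
    using linear_mapsD(1)[OF p] that by simp
  have p_eq: "p (x, y) = p (\<zero>\<^bsub>A\<^esub>, y)" if "x \<in> carrier A" "y \<in> carrier A" for x y
    using linear_mapsD(2)[OF p, of "(x, \<zero>\<^bsub>A\<^esub>)" "(\<zero>\<^bsub>A\<^esub>, y)"] that zero closed by simp
  \<comment> \<open>The lift axiom at (0, b). Its left side equals p(0, p(0, b)) because p(0, 0) =
    0.\<close>
  have lift: "p (p (\<zero>\<^bsub>A\<^esub>, \<zero>\<^bsub>A\<^esub>), p (\<zero>\<^bsub>A\<^esub>, b)) = p (\<zero>\<^bsub>A\<^esub>, b)"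
    using D b by (simp add: differential_object_def tan_map_def tan_lift_def)
  have "pairing tan_proj p \<in> alg_iso R P (tangent A) (prod_alg A A)"
    using D by (simp add: differential_object_def)
  then obtain h where h: "\<And>x. x \<in> carrier (tangent A) \<Longrightarrow> h (pairing tan_proj p x) = x"
    unfolding alg_iso_def by blast
  \<comment> \<open>Both points have first component zero, and idempotence makes the second
    components agree; the left inverse \<open>h\<close> then cancels the pairing.\<close>
  have "pairing tan_proj p (\<zero>\<^bsub>A\<^esub>, p (\<zero>\<^bsub>A\<^esub>, b)) = pairing tan_proj p (\<zero>\<^bsub>A\<^esub>, b)"
    using lift zero by (simp add: pairing_def tan_proj_def)
  then have "p (\<zero>\<^bsub>A\<^esub>, b) = b"
    using h[of "(\<zero>\<^bsub>A\<^esub>, p (\<zero>\<^bsub>A\<^esub>, b))"] h[of "(\<zero>\<^bsub>A\<^esub>, b)"] closed b by simp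
  then show ?thesis
    using p_eq[OF a b] by simp
qed

text \<open>For n = 1 the sum has a single term, in which the only entry of \<open>as\<close> is
  replaced by that of \<open>bs\<close>. Otherwise every term vanishes, the sum being empty for n =
  0. This identifies the operations of \<open>tangent A\<close> with those of the product.\<close>

lemma oper_deriv_eq_oper:
  assumes vanish: "\<And>n \<mu> as. \<lbrakk>n \<noteq> 1; \<mu> \<in> op_carrier P n; as \<in> tuples n A\<rbrakk> \<Longrightarrow> oper A n \<mu> as = \<zero>\<^bsub>A\<^esub>"
    and \<mu>: "\<mu> \<in> op_carrier P n" and as: "as \<in> tuples n A" and bs: "bs \<in> tuples n A"
  shows "oper_deriv A n \<mu> as bs = oper A n \<mu> bs"
proof (cases "n = 1")
  case True
  obtain a b where ab: "as = [a]" "bs = [b]"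
    using as bs True by (auto simp: listset_replicate length_Suc_conv)
  have "oper A 1 \<mu> [b] \<in> carrier A"
    using oper_closed[OF \<mu> bs] True ab by simp
  then show ?thesis
    using True ab by (simp add: oper_deriv_def lessThan_Suc)
next
  case False
  have "as[i := bs ! i] \<in> tuples n A" if "i < n" for i
    using as bs that
    by (auto simp: listset_replicate subset_eq dest!: set_update_subset_insert[THEN subsetD])
  then have "oper_deriv A n \<mu> as bs = (\<Oplus>\<^bsub>A\<^esub> i \<in> {..<n}. \<zero>\<^bsub>A\<^esub>)"
    unfolding oper_deriv_def
    by (intro M.finsum_cong) (auto simp: simp_implies_def vanish[OF False \<mu>])
  then show ?thesis
    by (simp add: vanish[OF False \<mu> bs])
qed

lemma differential_object_canonical:
  assumes vanish: "\<And>n \<mu> as. \<lbrakk>n \<noteq> 1; \<mu> \<in> op_carrier P n; as \<in> tuples n A\<rbrakk> \<Longrightarrow> oper A n \<mu> as = \<zero>\<^bsub>A\<^esub>"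
  shows "differential_object R P A snd (\<lambda>(x, y). x \<oplus>\<^bsub>A\<^esub> y) (\<lambda>_. \<zero>\<^bsub>A\<^esub>)"
proof -
  \<comment> \<open>The product carrier is written out because simplification brings tuples over
    \<open>tangent A\<close> and over \<open>prod_alg A A\<close> to this common form.\<close>
  have fst_tuples: "map fst xs \<in> tuples n A" and snd_tuples: "map snd xs \<in> tuples n A"
    if "xs \<in> listset (replicate n (carrier A \<times> carrier A))" for n and xs :: "('b \<times> 'b) list"
    using that by (auto simp: listset_replicate)
  have deriv: "oper_deriv A n \<mu> (map fst xs) (map snd xs) = oper A n \<mu> (map snd xs)"
    if "\<mu> \<in> op_carrier P n" "xs \<in> listset (replicate n (carrier A \<times> carrier A))" for n \<mu> xs
    using oper_deriv_eq_oper[OF vanish that(1) fst_tuples snd_tuples] that(2) by blast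
  have p: "snd \<in> alg_hom R P (tangent A) A"
    by (auto simp: alg_hom_def linear_maps_def deriv)
  \<comment> \<open>The required isomorphism is thus the identity, which is also its own
    inverse.\<close>
  have pair: "pairing tan_proj snd = id"
    by (auto simp: pairing_def tan_proj_def)
  have to: "id \<in> alg_hom R P (tangent A) (prod_alg A A)"
    by (auto simp: alg_hom_def linear_maps_def deriv)
  have fro: "id \<in> alg_hom R P (prod_alg A A) (tangent A)"
    by (auto simp: alg_hom_def linear_maps_def deriv)
  have iso: "pairing tan_proj snd \<in> alg_iso R P (tangent A) (prod_alg A A)"
    unfolding pair alg_iso_def using to fro by (auto intro!: bexI[of _ id])
  have \<sigma>_oper: "oper A n \<mu> (map fst xs) \<oplus>\<^bsub>A\<^esub> oper A n \<mu> (map snd xs) =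
      oper A n \<mu> (map (\<lambda>(x, y). x \<oplus>\<^bsub>A\<^esub> y) xs)"
    if \<mu>: "\<mu> \<in> op_carrier P n" and xs: "xs \<in> listset (replicate n (carrier A \<times> carrier A))"
    for n \<mu> xs
  proof (cases "n = 1")
    case True
    then obtain x y where "xs = [(x, y)]" "x \<in> carrier A" "y \<in> carrier A"
      using xs by (auto simp: listset_replicate length_Suc_conv)
    then show ?thesis
      using linear_mapsD(2)[OF oper_unary_linear, of \<mu> x y] \<mu> True by simp
  next
    case False
    have "map (\<lambda>(x, y). x \<oplus>\<^bsub>A\<^esub> y) xs \<in> tuples n A"
      using xs by (auto simp: listset_replicate)
    then show ?thesis
      using vanish[OF False \<mu>] fst_tuples[OF xs] snd_tuples[OF xs] by simp
  qed
  have \<sigma>: "(\<lambda>(x, y). x \<oplus>\<^bsub>A\<^esub> y) \<in> alg_hom R P (prod_alg A A) A"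
    by (auto simp: alg_hom_def linear_maps_def \<sigma>_oper smult_r_distr M.a_ac)
  \<comment> \<open>The hypothesis is needed only for constants; in positive arity the first
    argument is zero and multilinearity suffices.\<close>
  have \<zeta>_oper: "\<zero>\<^bsub>A\<^esub> = oper A n \<mu> (map (\<lambda>_. \<zero>\<^bsub>A\<^esub>) xs)"
    if "\<mu> \<in> op_carrier P n" "xs \<in> tuples n terminal_alg" for n \<mu> and xs :: "unit list"
  proof (cases "n = 0")
    case True
    then show ?thesis
      using vanish[of n \<mu> "[]"] that by simp
  next
    case False
    have "map (\<lambda>_. \<zero>\<^bsub>A\<^esub>) xs \<in> tuples n A" "length xs = n"
      using that(2) by (auto simp: listset_replicate)
    then show ?thesis
      using oper_zero_slot[OF that(1), of "map (\<lambda>_. \<zero>\<^bsub>A\<^esub>) xs" 0] False by simp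
  qed
  have \<zeta>: "(\<lambda>_. \<zero>\<^bsub>A\<^esub>) \<in> alg_hom R P terminal_alg A"
    by (auto simp: alg_hom_def linear_maps_def \<zeta>_oper[symmetric])
  show ?thesis
    unfolding differential_object_def comm_monoid_object_def
    using p iso \<sigma> \<zeta>
    by (auto simp: M.a_ac tan_sum_def tan_zero_def tan_map_def tan_prod_def tan_lift_def
        tan_q1_def tan_q2_def pairing_def)
qed

end

theorem proposition4p6p1:
  fixes R :: "('r, 's) ring_scheme"
    and P :: "('r, 'p) operad_data"
    and A :: "('r, 'a, 'p) alg_data"
  assumes "cring R" and "operad R P" and "operad_algebra R P A"
  shows "((\<exists>p \<sigma> \<zeta>. differential_object R P A p \<sigma> \<zeta>) \<longleftrightarrow>
            (\<forall>n. n \<noteq> 1 \<longrightarrow>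
               (\<forall>\<mu> \<in> op_carrier P n. \<forall>as \<in> tuples n A. oper A n \<mu> as = \<zero>\<^bsub>A\<^esub>)))
         \<and> (\<forall>p \<sigma> \<zeta> p' \<sigma>' \<zeta>'.
              differential_object R P A p \<sigma> \<zeta> \<and> differential_object R P A p' \<sigma>' \<zeta>' \<longrightarrow>
                (\<forall>x \<in> carrier (tangent A). p x = p' x) \<and>
                (\<forall>x \<in> carrier (prod_alg A A). \<sigma> x = \<sigma>' x) \<and>
                \<zeta> () = \<zeta>' ())"
proof -
  interpret operad_algebra R P A by (fact assms(3))
  have monoid: "comm_monoid_object R P A \<sigma> \<zeta>" if "differential_object R P A p \<sigma> \<zeta>" for p \<sigma> \<zeta>
    using that by (simp add: differential_object_def)
  have "(\<exists>p \<sigma> \<zeta>. differential_object R P A p \<sigma> \<zeta>) \<longleftrightarrow>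
      (\<forall>n. n \<noteq> 1 \<longrightarrow> (\<forall>\<mu> \<in> op_carrier P n. \<forall>as \<in> tuples n A. oper A n \<mu> as = \<zero>\<^bsub>A\<^esub>))"
    using differential_object_canonical monoid comm_monoid_object_oper by metis
  moreover have "(\<forall>x \<in> carrier (tangent A). p x = p' x) \<and>
      (\<forall>x \<in> carrier (prod_alg A A). \<sigma> x = \<sigma>' x) \<and> \<zeta> () = \<zeta>' ()"
    if "differential_object R P A p \<sigma> \<zeta>" "differential_object R P A p' \<sigma>' \<zeta>'"
    for p \<sigma> \<zeta> p' \<sigma>' \<zeta>'
    \<comment> \<open>Uniqueness holds since each structure map has a forced formula on its carrier:
      second projection, addition and zero.\<close>
    using that[THEN monoid] that
    by (auto simp: differential_object_snd comm_monoid_object_add comm_monoid_object_zero)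
  ultimately show ?thesis
    by blast
qed

end
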